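(* Let $N>1$ be an integer and let $z_1,\dots,z_N$ be pairwise distinct nonzero complex numbers. Define the complementary sequence $\tilde z_1,\dots,\tilde z_N$ by $$\frac{1}{\tilde z_k}=\sum_{i=1}^{k-1}\frac{1}{z_i-z_k}+\sum_{i=k+1}^{N}\left(\frac{1}{z_i-z_k}-\frac{1}{z_i}\right),\qquad 1\le k\le N,$$ where an empty sum is $0$. Then, as an identity of rational functions of $x$ (equivalently, for every complex $x\notin\{-z_1,\dots,-z_N\}$), $$\sum_{n=1}^{N}\frac{1}{z_n(z_n+x)}\sum_{m=1}^{n-1}\frac{1}{z_m+x}=\sum_{n=1}^{N}\frac{1}{z_n\tilde z_n}\cdot\frac{1}{z_n+x}.$$
   Context: The numbers $z_i$ must be pairwise distinct for the defining sums of $1/\tilde z_k$ to make sense (here $1/\tilde z_k$ may be $0$; only $1/\tilde z_k$ enters the formula). *)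

theory Defs
  imports Complex_Main
begin

(* The reciprocal 1/z~_k of the k-th term of the complementary sequence. The reciprocal itself
   is the primitive notion, because it may vanish, in which case z~_k is infinite. *)
definition recip_complementary :: "nat \<Rightarrow> (nat \<Rightarrow> complex) \<Rightarrow> nat \<Rightarrow> complex" where
  "recip_complementary N z k =
     (\<Sum>i = 1..<k. 1 / (z i - z k)) + (\<Sum>i = k+1..N. 1 / (z i - z k) - 1 / z i)"

end

theory Submission
  imports Defs
begin

text \<open>
  Partial fractions split each summand of the left-hand side, indexed by a pair \<open>m < n\<close>, into a
  multiple of \<open>1 / (z n + x)\<close> and a multiple of \<open>1 / (z m + x)\<close>. The first is a term of the first
  sum in \<open>recip_complementary N z n\<close>, the second a term of the second sum in
  \<open>recip_complementary N z m\<close>, because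
  \<open>1 / z m * (1 / (z n - z m) - 1 / z n) = 1 / (z n * (z n - z m))\<close>.
\<close>

lemma sum_swap_upper_triangle:
  fixes f :: "nat \<Rightarrow> nat \<Rightarrow> 'a::comm_monoid_add"
  shows "(\<Sum>m = a..b. \<Sum>n = m+1..b. f m n) = (\<Sum>n = a..b. \<Sum>m = a..<n. f m n)"
proof -
  have "(\<Sum>m = a..b. \<Sum>n = m+1..b. f m n) = (\<Sum>m = a..b. \<Sum>n | n \<in> {a..b} \<and> m < n. f m n)"
    by (intro sum.cong) auto
  also have "\<dots> = (\<Sum>n = a..b. \<Sum>m | m \<in> {a..b} \<and> m < n. f m n)"
    by (rule sum.swap_restrict) auto
  also have "\<dots> = (\<Sum>n = a..b. \<Sum>m = a..<n. f m n)"
    by (intro sum.cong) auto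
  finally show ?thesis .
qed

text \<open>The coefficient of \<open>1 / (u + x)\<close> is left unsimplified so that, with
  \<open>u = z m\<close> and \<open>v = z n\<close>, it matches a summand of
  \<open>recip_complementary\<close> literally.\<close>

lemma inverse_product_partial_fractions:
  fixes u v x :: "'a::field"
  assumes "u \<noteq> 0" "v \<noteq> 0" "u \<noteq> v" "u + x \<noteq> 0" "v + x \<noteq> 0"
  shows "1 / (v * (v + x)) * (1 / (u + x))
       = 1 / v * (1 / (u - v)) * (1 / (v + x)) + 1 / u * (1 / (v - u) - 1 / v) * (1 / (u + x))"
proof -
  have d: "u - v \<noteq> 0" "v - u \<noteq> 0"
    using assms by auto
  \<comment> \<open>The two coefficients are opposite, so only the difference
    \<open>1 / (v + x) - 1 / (u + x)\<close> matters; its factor \<open>u - v\<close>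
    cancels.\<close>
  have "1 / u * (1 / (v - u) - 1 / v) = - (1 / v * (1 / (u - v)))"
    using assms d by (simp add: divide_simps)
  moreover have "1 / (v + x) - 1 / (u + x) = (u - v) * (1 / (v + x) * (1 / (u + x)))"
    using assms by (simp add: field_simps)
  ultimately have "1 / v * (1 / (u - v)) * (1 / (v + x)) + 1 / u * (1 / (v - u) - 1 / v) * (1 / (u + x))
      = 1 / v * (1 / (u - v)) * ((u - v) * (1 / (v + x) * (1 / (u + x))))"
    by (metis (no_types, lifting) add_uminus_conv_diff mult_minus_left right_diff_distrib)
  then show ?thesis
    using d by simp
qed

theorem theorem3p1:
  fixes N :: nat and z :: "nat \<Rightarrow> complex" and x :: complex
  assumes "N > 1"
    and "inj_on z {1..N}"
    and "\<And>i. i \<in> {1..N} \<Longrightarrow> z i \<noteq> 0"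
    and "x \<notin> (\<lambda>i. - z i) ` {1..N}"
  shows "(\<Sum>n = 1..N. 1 / (z n * (z n + x)) * (\<Sum>m = 1..<n. 1 / (z m + x)))
       = (\<Sum>n = 1..N. 1 / z n * recip_complementary N z n * (1 / (z n + x)))"
proof -
  define A where "A m n = 1 / z n * (1 / (z m - z n)) * (1 / (z n + x))" for m n
  define B where "B m n = 1 / z m * (1 / (z n - z m) - 1 / z n) * (1 / (z m + x))" for m n
  have nz: "z i + x \<noteq> 0" if "i \<in> {1..N}" for i
    using assms(4) that by (metis add_eq_0_iff image_eqI)
  have split: "1 / (z n * (z n + x)) * (1 / (z m + x)) = A m n + B m n"
    if "n \<in> {1..N}" "m \<in> {1..<n}" for m n
  proof -
    have m: "m \<in> {1..N}" "m \<noteq> n"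
      using that by auto
    then have "z m \<noteq> z n"
      using assms(2) that(1) by (auto dest: inj_onD)
    then show ?thesis
      unfolding A_def B_def using assms(3) nz that(1) m
      by (intro inverse_product_partial_fractions) auto
  qed
  have "(\<Sum>n = 1..N. 1 / (z n * (z n + x)) * (\<Sum>m = 1..<n. 1 / (z m + x)))
      = (\<Sum>n = 1..N. \<Sum>m = 1..<n. A m n + B m n)"
    unfolding sum_distrib_left using split by (intro sum.cong refl) blast
  \<comment> \<open>Only \<open>B\<close> is regrouped, by its smaller index \<open>m\<close>, since
    its pole is at \<open>x = - z m\<close>.\<close>
  also have "\<dots> = (\<Sum>n = 1..N. \<Sum>m = 1..<n. A m n) + (\<Sum>m = 1..N. \<Sum>n = m+1..N. B m n)"
    by (simp only: sum.distrib sum_swap_upper_triangle)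
  \<comment> \<open>Up to renaming bound indices, only distributivity remains.\<close>
  also have "\<dots> = (\<Sum>n = 1..N. 1 / z n * recip_complementary N z n * (1 / (z n + x)))"
    unfolding recip_complementary_def A_def B_def
    by (simp only: sum.distrib distrib_left distrib_right sum_distrib_left sum_distrib_right)
  finally show ?thesis .
qed

end
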